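(* Let $M$ be a finite-dimensional vector space over a field $\mathbf k$ of characteristic zero with a finite decreasing filtration $M=F^0M\supseteq F^1M\supseteq\cdots\supseteq F^{d+1}M=0$, let $\mathcal Y$ be a $\mathbf k$-vector space with an increasing filtration $0=K_{-1}\mathcal Y\subseteq K_0\mathcal Y\subseteq\cdots\subseteq K_d\mathcal Y=\mathcal Y$, and let $\mathcal R:M^*\to\mathcal Y$ be a filtered response. The following are equivalent: (i) $\mathcal R$ is strict; (ii) every map $\operatorname{gr}_r\mathcal R$ is injective; (iii) $\nu_K(\mathcal Rq)=a_F(q)$ for every $q\in M^*$; (iv) the induced Rees map $\operatorname{Rees}(\mathcal R)$ is injective and has $u$-saturated image; (v) the Rees map $\operatorname{Rees}(\mathcal R)$ is injective and its cokernel has no $u$-torsion. Under these equivalent conditions, $$F^rM=\bigcap_{\substack{q\in M^*\\ \nu_K(\mathcal Rq)\le r-1}}\ker q$$ for every $r$.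
   Context: The dual filtration is the increasing filtration $\mathscr D_rM^*=(F^{r+1}M)^\perp$ (annihilator in $M^*$), $\mathscr D_{-1}M^*=0$. With $G_r=F^rM/F^{r+1}M$, restriction identifies $\mathscr D_rM^*/\mathscr D_{r-1}M^*\cong G_r^*$. For $q\ne0$, $a_F(q)=\min\{r:q\in\mathscr D_rM^*\}=\max\{r:q(F^rM)\neq0\}$, and $a_F(0)=-\infty$. For $0\ne y\in\mathcal Y$, $\nu_K(y)=\min\{r:y\in K_r\mathcal Y\}$, and $\nu_K(0)=-\infty$. A linear map $\mathcal R:M^*\to\mathcal Y$ is a filtered response if $\mathcal R(\mathscr D_rM^* )\subseteq K_r\mathcal Y$ for every $r$; it is strict if $\mathcal R^{-1}(K_r\mathcal Y)=\mathscr D_rM^*$ for $-1\le r\le d$. With $\partial_r\mathcal Y=K_r\mathcal Y/K_{r-1}\mathcal Y$, a filtered map induces $\operatorname{gr}_r\mathcal R:G_r^*\to\partial_r\mathcal Y$ for $0\le r\le d$. Extend both filtrations constantly above degree $d$. The Rees map is the $\mathbf k[u]$-linear map $$\operatorname{Rees}(\mathcal R):\bigoplus_{r\ge0}\mathscr D_rM^*u^r\to\bigoplus_{r\ge0}K_r\mathcal Y u^r,\qquad qu^r\mapsto\mathcal R(q)u^r.$$ A graded submodule $I$ of the target is $u$-saturated when $uy\in I$ implies $y\in I$. *)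

theory Defs
  imports
    "HOL-Library.Extended"
    "HOL-Library.FuncSet"
    "HOL-Library.Function_Algebras"
    "HOL-Library.Set_Algebras"
    "HOL-Computational_Algebra.Polynomial"
begin

text \<open>
  The ambient spaces \<open>M\<close> and \<open>Y\<close> are whole types with explicit scalar multiplications \<open>sM\<close> and
  \<open>sY\<close>; the dual of \<open>M\<close> is a subspace of the function space \<open>'m \<Rightarrow> 'k\<close>, so a linear map out of
  the dual is a function constrained on that subspace only.  Cosets are written \<open>x +o S\<close>.
\<close>

section \<open>Linear maps on subspaces, quotients\<close>

definition linear_map_on ::
  "'v set \<Rightarrow> ('a \<Rightarrow> 'v \<Rightarrow> 'v) \<Rightarrow> ('a \<Rightarrow> 'w \<Rightarrow> 'w) \<Rightarrow> ('v::plus \<Rightarrow> 'w::plus) \<Rightarrow> bool"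
  where "linear_map_on S s t f \<longleftrightarrow>
    (\<forall>x\<in>S. \<forall>y\<in>S. f (x + y) = f x + f y) \<and> (\<forall>c. \<forall>x\<in>S. f (s c x) = t c (f x))"

definition quot :: "'v::plus set \<Rightarrow> 'v set \<Rightarrow> 'v set set"
  where "quot A S = (\<lambda>x. x +o S) ` A"

text \<open>The value at a coset of a function that is constant on that coset.\<close>

definition descend :: "('v \<Rightarrow> 'w) \<Rightarrow> 'v set \<Rightarrow> 'w"
  where "descend f C = the_elem (f ` C)"

definition dual :: "('k::field \<Rightarrow> 'm::ab_group_add \<Rightarrow> 'm) \<Rightarrow> ('m \<Rightarrow> 'k) set"
  where "dual sM = {q. Vector_Spaces.linear sM (*) q}"

definition dual_scale :: "'k::times \<Rightarrow> ('m \<Rightarrow> 'k) \<Rightarrow> 'm \<Rightarrow> 'k"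
  where "dual_scale c q = (\<lambda>x. c * q x)"

definition annihilator :: "('k::field \<Rightarrow> 'm::ab_group_add \<Rightarrow> 'm) \<Rightarrow> 'm set \<Rightarrow> ('m \<Rightarrow> 'k) set"
  where "annihilator sM S = {q \<in> dual sM. \<forall>x\<in>S. q x = 0}"

section \<open>Filtrations\<close>

text \<open>
  Filtrations are indexed by integers.  Only the values \<open>F r\<close> for \<open>0 \<le> r \<le> d + 1\<close> and \<open>K r\<close> for
  \<open>-1 \<le> r \<le> d\<close> are meaningful, and nothing below depends on other values.
\<close>

definition decreasing_filtration ::
  "('k::field \<Rightarrow> 'm::ab_group_add \<Rightarrow> 'm) \<Rightarrow> nat \<Rightarrow> (int \<Rightarrow> 'm set) \<Rightarrow> bool"
  where "decreasing_filtration sM d F \<longleftrightarrow>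
    (\<forall>r\<in>{0..int d + 1}. module.subspace sM (F r)) \<and>
    (\<forall>r\<in>{0..int d}. F (r + 1) \<subseteq> F r) \<and> F 0 = UNIV \<and> F (int d + 1) = {0}"

definition increasing_filtration ::
  "('k::field \<Rightarrow> 'y::ab_group_add \<Rightarrow> 'y) \<Rightarrow> nat \<Rightarrow> (int \<Rightarrow> 'y set) \<Rightarrow> bool"
  where "increasing_filtration sY d K \<longleftrightarrow>
    (\<forall>r\<in>{-1..int d}. module.subspace sY (K r)) \<and>
    (\<forall>r\<in>{-1..<int d}. K r \<subseteq> K (r + 1)) \<and> K (-1) = {0} \<and> K (int d) = UNIV"

definition dual_filtration ::
  "('k::field \<Rightarrow> 'm::ab_group_add \<Rightarrow> 'm) \<Rightarrow> (int \<Rightarrow> 'm set) \<Rightarrow> int \<Rightarrow> ('m \<Rightarrow> 'k) set"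
  where "dual_filtration sM F r = annihilator sM (F (r + 1))"

text \<open>The level of an element for an increasing filtration, \<open>-\<infinity>\<close> at zero.\<close>

definition filt_level :: "nat \<Rightarrow> (int \<Rightarrow> 'v::zero set) \<Rightarrow> 'v \<Rightarrow> int extended"
  where "filt_level d A x = (if x = 0 then -\<infinity> else Fin (Min {r \<in> {-1..int d}. x \<in> A r}))"

definition a_F ::
  "('k::field \<Rightarrow> 'm::ab_group_add \<Rightarrow> 'm) \<Rightarrow> nat \<Rightarrow> (int \<Rightarrow> 'm set) \<Rightarrow> ('m \<Rightarrow> 'k) \<Rightarrow> int extended"
  where "a_F sM d F = filt_level d (dual_filtration sM F)"

definition nu_K :: "nat \<Rightarrow> (int \<Rightarrow> 'y::zero set) \<Rightarrow> 'y \<Rightarrow> int extended"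
  where "nu_K d K = filt_level d K"

definition filtered_response ::
  "('k::field \<Rightarrow> 'm::ab_group_add \<Rightarrow> 'm) \<Rightarrow> ('k \<Rightarrow> 'y::ab_group_add \<Rightarrow> 'y) \<Rightarrow> nat \<Rightarrow>
    (int \<Rightarrow> 'm set) \<Rightarrow> (int \<Rightarrow> 'y set) \<Rightarrow> (('m \<Rightarrow> 'k) \<Rightarrow> 'y) \<Rightarrow> bool"
  where "filtered_response sM sY d F K R \<longleftrightarrow>
    linear_map_on (dual sM) dual_scale sY R \<and>
    (\<forall>r\<in>{-1..int d}. R ` dual_filtration sM F r \<subseteq> K r)"

definition strict_response ::
  "('k::field \<Rightarrow> 'm::ab_group_add \<Rightarrow> 'm) \<Rightarrow> nat \<Rightarrow>
    (int \<Rightarrow> 'm set) \<Rightarrow> (int \<Rightarrow> 'y set) \<Rightarrow> (('m \<Rightarrow> 'k) \<Rightarrow> 'y) \<Rightarrow> bool"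
  where "strict_response sM d F K R \<longleftrightarrow>
    (\<forall>r\<in>{-1..int d}. {q \<in> dual sM. R q \<in> K r} = dual_filtration sM F r)"

section \<open>Associated graded maps\<close>

definition gr_F :: "(int \<Rightarrow> 'm::plus set) \<Rightarrow> int \<Rightarrow> 'm set set"
  where "gr_F F r = quot (F r) (F (r + 1))"

definition gr_incr :: "(int \<Rightarrow> 'v::plus set) \<Rightarrow> int \<Rightarrow> 'v set set"
  where "gr_incr A r = quot (A r) (A (r - 1))"

text \<open>
  The linear dual of the graded piece \<open>gr_F F r\<close>.  Sums and multiples of cosets are expressed
  through representatives, since pointwise scaling of a coset by \<open>0\<close> is not the zero coset.
  Functionals are \<^const>\<open>extensional\<close>, so that equality means equality on the quotient.
\<close>

definition gr_F_dual ::
  "('k::field \<Rightarrow> 'm::ab_group_add \<Rightarrow> 'm) \<Rightarrow> (int \<Rightarrow> 'm set) \<Rightarrow> int \<Rightarrow> ('m set \<Rightarrow> 'k) set"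
  where "gr_F_dual sM F r = {\<phi> \<in> extensional (gr_F F r).
    linear_map_on (F r) sM (*) (\<lambda>x. \<phi> (x +o F (r + 1)))}"

definition restrict_gr :: "(int \<Rightarrow> 'm::plus set) \<Rightarrow> int \<Rightarrow> ('m \<Rightarrow> 'k) \<Rightarrow> 'm set \<Rightarrow> 'k"
  where "restrict_gr F r q = (\<lambda>C\<in>gr_F F r. descend q C)"

text \<open>
  The graded map is the map induced on \<open>dual_filtration sM F r / dual_filtration sM F (r - 1)\<close>,
  transported along the isomorphism of this quotient with \<open>gr_F_dual sM F r\<close> given by restriction
  (see \<open>restrict_gr_bij\<close> below).
\<close>

definition gr_map ::
  "('k::field \<Rightarrow> 'm::ab_group_add \<Rightarrow> 'm) \<Rightarrow> (int \<Rightarrow> 'm set) \<Rightarrow> (int \<Rightarrow> 'y::plus set) \<Rightarrow>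
    (('m \<Rightarrow> 'k) \<Rightarrow> 'y) \<Rightarrow> int \<Rightarrow> ('m set \<Rightarrow> 'k) \<Rightarrow> 'y set"
  where "gr_map sM F K R r \<phi> =
    descend (\<lambda>q. R q +o K (r - 1))
      (inv_into (gr_incr (dual_filtration sM F) r) (descend (restrict_gr F r)) \<phi>)"

section \<open>Rees modules\<close>

text \<open>
  The elements of \<open>\<Oplus>\<^sub>r V u\<^sup>r\<close> are finitely supported sequences in \<open>V\<close>, that is, elements of the
  type \<open>'v poly\<close>; the polynomial ring over the field acts on them by convolution.
\<close>

definition poly_scale :: "('k::zero \<Rightarrow> 'v \<Rightarrow> 'v) \<Rightarrow> 'k poly \<Rightarrow> 'v poly \<Rightarrow> 'v::comm_monoid_add poly"
  where "poly_scale s p x = fold_coeffs (\<lambda>a z. map_poly (s a) x + pCons 0 z) p 0"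

abbreviation u_var :: "'k::comm_semiring_1 poly"
  where "u_var \<equiv> [:0, 1:]"

definition rees :: "nat \<Rightarrow> (int \<Rightarrow> 'v::zero set) \<Rightarrow> 'v poly set"
  where "rees d A = {x. \<forall>r::nat. coeff x r \<in> A (min (int r) (int d))}"

definition rees_map :: "(('m \<Rightarrow> 'k::zero) \<Rightarrow> 'y::zero) \<Rightarrow> ('m \<Rightarrow> 'k) poly \<Rightarrow> 'y poly"
  where "rees_map R = map_poly R"

definition u_saturated ::
  "('k::comm_semiring_1 \<Rightarrow> 'v \<Rightarrow> 'v) \<Rightarrow> 'v::comm_monoid_add poly set \<Rightarrow> 'v poly set \<Rightarrow> bool"
  where "u_saturated s T I \<longleftrightarrow> (\<forall>x\<in>T. poly_scale s u_var x \<in> I \<longrightarrow> x \<in> I)"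

text \<open>The action of the polynomial ring on the quotient module \<open>T / I\<close>.\<close>

definition quot_scale ::
  "('k::zero \<Rightarrow> 'v \<Rightarrow> 'v) \<Rightarrow> 'v::comm_monoid_add poly set \<Rightarrow> 'k poly \<Rightarrow> 'v poly set \<Rightarrow> 'v poly set"
  where "quot_scale s I p = descend (\<lambda>x. poly_scale s p x +o I)"

definition no_u_torsion_quot ::
  "('k::comm_semiring_1 \<Rightarrow> 'v \<Rightarrow> 'v) \<Rightarrow> 'v::comm_monoid_add poly set \<Rightarrow> 'v poly set \<Rightarrow> bool"
  where "no_u_torsion_quot s T I \<longleftrightarrow>
    (\<forall>C\<in>quot T I. \<forall>n. quot_scale s I (u_var ^ n) C = 0 +o I \<longrightarrow> C = 0 +o I)"

section \<open>Well-definedness of the constructions\<close>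

lemma descend_coset:
  assumes "0 \<in> S" "\<And>t. t \<in> S \<Longrightarrow> f (x + t) = f (x::'v::monoid_add)"
  shows "descend f (x +o S) = f x"
proof -
  have "f ` (x +o S) = {f x}"
    using assms by (force simp: elt_set_plus_def image_iff)
  then show ?thesis by (simp add: descend_def)
qed

lemma coset_eq_iff:
  assumes "module s" "module.subspace s S"
  shows "x +o S = y +o S \<longleftrightarrow> x - y \<in> S"
proof -
  interpret module s by fact
  show ?thesis
  proof
    assume "x +o S = y +o S"
    moreover have "x \<in> x +o S"
      using subspace_0[OF assms(2)] by (force simp: elt_set_plus_def)
    ultimately show "x - y \<in> S" by (simp add: set_minus_plus)
  next
    assume *: "x - y \<in> S"
    show "x +o S = y +o S"
    proof (intro set_eqI iffI)
      fix z assume "z \<in> x +o S"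
      then have "z - x \<in> S" by (simp add: set_minus_plus)
      from subspace_add[OF assms(2) this *] show "z \<in> y +o S"
        by (simp add: set_minus_plus[symmetric])
    next
      fix z assume "z \<in> y +o S"
      then have "z - y \<in> S" by (simp add: set_minus_plus)
      from subspace_diff[OF assms(2) this *] show "z \<in> x +o S"
        by (simp add: set_minus_plus[symmetric])
    qed
  qed
qed

lemma dual_vector_space: "vector_space (dual_scale :: 'k::field \<Rightarrow> ('m \<Rightarrow> 'k) \<Rightarrow> 'm \<Rightarrow> 'k)"
  by unfold_locales (auto simp: dual_scale_def fun_eq_iff distrib_left distrib_right)

lemma dual_iff:
  assumes "vector_space sM"
  shows "q \<in> dual sM \<longleftrightarrow> (\<forall>x y. q (x + y) = q x + q y) \<and> (\<forall>c x. q (sM c x) = c * q x)"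
proof -
  interpret vector_space sM by fact
  have "vector_space ((*) :: 'a \<Rightarrow> 'a \<Rightarrow> 'a)"
    by unfold_locales (auto simp: distrib_left distrib_right)
  then show ?thesis
    using assms by (simp add: dual_def Vector_Spaces.linear_iff)
qed

lemma annihilator_subspace:
  assumes "vector_space sM"
  shows "module.subspace dual_scale (annihilator sM S)"
proof -
  interpret vector_space "dual_scale :: 'a \<Rightarrow> ('b \<Rightarrow> 'a) \<Rightarrow> 'b \<Rightarrow> 'a"
    by (rule dual_vector_space)
  show ?thesis
    by (rule subspaceI) (auto simp: annihilator_def dual_iff[OF assms] dual_scale_def distrib_left)
qed

lemma linear_map_on_extend:
  assumes "vector_space sM" "module.subspace sM S" "linear_map_on S sM (*) f"
  shows "\<exists>q\<in>dual sM. \<forall>x\<in>S. q x = (f x :: 'k::field)"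
proof -
  interpret vs: vector_space sM by fact
  interpret vp: vector_space_pair sM "(*) :: 'k \<Rightarrow> 'k \<Rightarrow> 'k"
    by unfold_locales (auto simp: distrib_left distrib_right)
  obtain B where B: "B \<subseteq> S" "vs.independent B" "S \<subseteq> vs.span B"
    by (rule vs.basis_exists)
  obtain q where q: "Vector_Spaces.linear sM (*) q" "\<forall>x\<in>B. q x = f x"
    using vp.linear_independent_extend[OF B(2)] by blast
  have lin: "q (x + y) = q x + q y" "q (sM c x) = c * q x" for x y c
    using q(1) by (auto simp: Vector_Spaces.linear_iff)
  have q0: "q 0 = 0" using lin(2)[of 0 0] by simp
  have f0: "f 0 = 0"
  proof -
    have "f (sM 0 0) = 0 * f 0"
      using assms(3) vs.subspace_0[OF assms(2)] unfolding linear_map_on_def by blast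
    then show ?thesis by simp
  qed
  have "x \<in> S \<and> q x = f x" if "x \<in> vs.span B" for x
    using that
  proof (induction rule: vs.span_induct_alt)
    case base
    then show ?case using vs.subspace_0[OF assms(2)] q0 f0 by simp
  next
    case (step c x y)
    then have x: "x \<in> S" "q x = f x" using B(1) q(2) by auto
    have cx: "sM c x \<in> S" using vs.subspace_scale[OF assms(2) x(1)] .
    have "f (sM c x + y) = f (sM c x) + f y" "f (sM c x) = c * f x"
      using assms(3) x(1) cx step unfolding linear_map_on_def by blast+
    then show ?case using step x(2) vs.subspace_add[OF assms(2) cx] by (simp add: lin)
  qed
  then have "\<forall>x\<in>S. q x = f x" using B(3) by blast
  then show ?thesis using q(1) by (auto simp: dual_def)
qed

lemma restrict_gr_bij:
  fixes sM :: "'k::field \<Rightarrow> 'm::ab_group_add \<Rightarrow> 'm"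
  assumes "vector_space sM" "decreasing_filtration sM d F" "r \<in> {0..int d}"
  shows "bij_betw (descend (restrict_gr F r))
    (gr_incr (dual_filtration sM F) r) (gr_F_dual sM F r)"
proof -
  interpret vs: vector_space sM by fact
  have S: "vs.subspace (F r)" "vs.subspace (F (r + 1))" "F (r + 1) \<subseteq> F r"
    using assms(2,3) by (auto simp: decreasing_filtration_def)
  note z = vs.subspace_0[OF S(1)] vs.subspace_0[OF S(2)]
  have D: "q \<in> dual_filtration sM F r \<longleftrightarrow> q \<in> dual sM \<and> (\<forall>x\<in>F (r + 1). q x = 0)"
    "q \<in> dual_filtration sM F (r - 1) \<longleftrightarrow> q \<in> dual sM \<and> (\<forall>x\<in>F r. q x = 0)" for q
    by (auto simp: dual_filtration_def annihilator_def)
  note di = dual_iff[OF assms(1)]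
  have val: "restrict_gr F r q (x +o F (r + 1)) = q x"
    if "q \<in> dual_filtration sM F r" "x \<in> F r" for q x
  proof -
    have "descend q (x +o F (r + 1)) = q x"
      by (rule descend_coset) (use that z D di in auto)
    then show ?thesis using that by (simp add: restrict_gr_def gr_F_def quot_def)
  qed
  have eqI: "f = g" if "f \<in> extensional (gr_F F r)" "g \<in> extensional (gr_F F r)"
    "\<And>x. x \<in> F r \<Longrightarrow> f (x +o F (r + 1)) = g (x +o F (r + 1))" for f g :: "'m set \<Rightarrow> 'k"
    by (rule extensionalityI[OF that(1,2)]) (use that(3) in \<open>auto simp: gr_F_def quot_def\<close>)
  have ext: "restrict_gr F r q \<in> extensional (gr_F F r)" for q :: "'m \<Rightarrow> 'k"
    by (simp add: restrict_gr_def)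
  have sub: "q + t \<in> dual_filtration sM F r"
    if "q \<in> dual_filtration sM F r" "t \<in> dual_filtration sM F (r - 1)" for q t
    using that S(3) unfolding D di by (auto simp: algebra_simps)
  have cos: "descend (restrict_gr F r) (q +o dual_filtration sM F (r - 1)) = restrict_gr F r q"
    if q: "q \<in> dual_filtration sM F r" for q
  proof (rule descend_coset)
    show "0 \<in> dual_filtration sM F (r - 1)" by (simp add: D di)
    show "restrict_gr F r (q + t) = restrict_gr F r q"
      if t: "t \<in> dual_filtration sM F (r - 1)" for t
      by (rule eqI[OF ext ext]) (use t val[OF q] val[OF sub[OF q t]] D in auto)
  qed
  note dsub = annihilator_subspace[OF assms(1)]
  show ?thesis
    unfolding bij_betw_def
  proof (intro conjI)
    show "inj_on (descend (restrict_gr F r)) (gr_incr (dual_filtration sM F) r)"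
    proof (rule inj_onI, unfold gr_incr_def quot_def, clarify)
      fix p q assume p: "p \<in> dual_filtration sM F r" and q: "q \<in> dual_filtration sM F r"
        and "descend (restrict_gr F r) (p +o dual_filtration sM F (r - 1)) =
          descend (restrict_gr F r) (q +o dual_filtration sM F (r - 1))"
      then have "restrict_gr F r p = restrict_gr F r q" by (simp add: cos)
      then have "\<forall>x\<in>F r. p x = q x" using val[OF p] val[OF q] by metis
      then have "p - q \<in> dual_filtration sM F (r - 1)"
        using p q unfolding D di by (auto simp: algebra_simps)
      then show "p +o dual_filtration sM F (r - 1) = q +o dual_filtration sM F (r - 1)"
        using coset_eq_iff[OF module_iff_vector_space[THEN iffD2, OF dual_vector_space] dsub] by (simp add: dual_filtration_def)
    qed
    show "descend (restrict_gr F r) ` gr_incr (dual_filtration sM F) r = gr_F_dual sM F r"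
    proof (intro set_eqI iffI)
      fix f assume "f \<in> descend (restrict_gr F r) ` gr_incr (dual_filtration sM F) r"
      then obtain q where q: "q \<in> dual_filtration sM F r" "f = restrict_gr F r q"
        by (auto simp: gr_incr_def quot_def cos)
      then show "f \<in> gr_F_dual sM F r"
        using ext[of q] vs.subspace_add[OF S(1)] vs.subspace_scale[OF S(1)] D(1) di
        by (simp add: gr_F_dual_def linear_map_on_def val)
    next
      fix f assume f: "f \<in> gr_F_dual sM F r"
      then have lin: "linear_map_on (F r) sM (*) (\<lambda>x. f (x +o F (r + 1)))"
        by (simp add: gr_F_dual_def)
      from linear_map_on_extend[OF assms(1) S(1) lin] obtain q where
        q: "q \<in> dual sM" "\<And>x. x \<in> F r \<Longrightarrow> q x = f (x +o F (r + 1))" by blast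
      have "q x = 0" if "x \<in> F (r + 1)" for x
      proof -
        have "x +o F (r + 1) = 0 +o F (r + 1)"
          using that coset_eq_iff[OF vs.module_axioms S(2), of x 0] by simp
        then have "q x = q 0" using that S(3) q(2) z by auto
        then show ?thesis using q(1) di by (metis add_cancel_right_right)
      qed
      then have qD: "q \<in> dual_filtration sM F r" using q D by auto
      have "f = restrict_gr F r q"
        by (rule eqI) (use f ext q val[OF qD] in \<open>auto simp: gr_F_dual_def\<close>)
      then show "f \<in> descend (restrict_gr F r) ` gr_incr (dual_filtration sM F) r"
        using cos[OF qD] qD unfolding gr_incr_def quot_def by (metis imageI)
    qed
  qed
qed

lemma gr_map_restrict:
  assumes "vector_space sM" "vector_space sY"
    and "decreasing_filtration sM d F" "increasing_filtration sY d K"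
    and R: "filtered_response sM sY d F K R"
    and r: "r \<in> {0..int d}" and q: "q \<in> dual_filtration sM F r"
  shows "gr_map sM F K R r (descend (restrict_gr F r) (q +o dual_filtration sM F (r - 1))) =
    R q +o K (r - 1)"
proof -
  interpret vy: vector_space sY by fact
  have K: "vy.subspace (K (r - 1))" using assms(4) r by (auto simp: increasing_filtration_def)
  have "q +o dual_filtration sM F (r - 1) \<in> gr_incr (dual_filtration sM F) r"
    using q by (simp add: gr_incr_def quot_def)
  then have "gr_map sM F K R r (descend (restrict_gr F r) (q +o dual_filtration sM F (r - 1))) =
      descend (\<lambda>q. R q +o K (r - 1)) (q +o dual_filtration sM F (r - 1))"
    using restrict_gr_bij[OF assms(1,3) r] by (simp add: gr_map_def bij_betw_def inv_into_f_f)
  also have "\<dots> = R q +o K (r - 1)"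
  proof (rule descend_coset)
    show "0 \<in> dual_filtration sM F (r - 1)"
      by (simp add: dual_filtration_def annihilator_def dual_iff[OF assms(1)])
    show "R (q + t) +o K (r - 1) = R q +o K (r - 1)"
      if t: "t \<in> dual_filtration sM F (r - 1)" for t
    proof -
      have "q \<in> dual sM" "t \<in> dual sM"
        using q t by (auto simp: dual_filtration_def annihilator_def)
      then have "R (q + t) = R q + R t"
        using R by (simp add: filtered_response_def linear_map_on_def)
      moreover have "r - 1 \<in> {-1..int d}" using r by auto
      then have "R t \<in> K (r - 1)" using R t unfolding filtered_response_def by blast
      ultimately show ?thesis by (simp add: coset_eq_iff[OF vy.module_axioms K])
    qed
  qed
  finally show ?thesis .
qed

lemma a_F_eq_Max:
  assumes "vector_space sM" "decreasing_filtration sM d F" "q \<in> dual sM" "q \<noteq> 0"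
  shows "a_F sM d F q = Fin (Max {r \<in> {0..int d}. \<exists>x\<in>F r. q x \<noteq> 0})"
proof -
  interpret vs: vector_space sM by fact
  let ?N = "{r \<in> {0..int d}. \<exists>x\<in>F r. q x \<noteq> 0}"
  let ?D = "{r \<in> {-1..int d}. q \<in> dual_filtration sM F r}"
  have F: "F 0 = UNIV" "F (int d + 1) = {0}" "\<And>r. r \<in> {0..int d} \<Longrightarrow> F (r + 1) \<subseteq> F r"
    using assms(2) by (auto simp: decreasing_filtration_def)
  have q0: "q 0 = 0" using assms(1,3) by (metis dual_iff add_cancel_right_right)
  have fin: "finite ?N" "finite ?D"
    by (rule finite_subset[of _ "{-1..int d}"]; auto)+
  have D: "r \<in> ?D \<longleftrightarrow> r \<in> {-1..int d} \<and> (\<forall>x\<in>F (r + 1). q x = 0)" for r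
    using assms(3) by (auto simp: dual_filtration_def annihilator_def)
  have anti: "F j \<subseteq> F i" if "0 \<le> i" "i \<le> j" "j \<le> int d + 1" for i j
    using that(2,1,3)
  proof (induction rule: int_ge_induct)
    case (step j)
    then show ?case using F(3)[of j] by auto
  qed simp
  have "0 \<in> ?N" using assms(4) F(1) by (auto simp: fun_eq_iff)
  then have ne: "?N \<noteq> {}" by blast
  let ?m = "Max ?N"
  have m: "?m \<in> ?N" using Max_in[OF fin(1) ne] .
  have mD: "?m \<in> ?D"
  proof -
    have "\<forall>x\<in>F (?m + 1). q x = 0"
    proof (rule ccontr)
      assume nz: "\<not> ?thesis"
      then have "?m + 1 \<noteq> int d + 1" using F(2) q0 by auto
      then have "?m + 1 \<in> ?N" using nz m by auto
      from Max_ge[OF fin(1) this] show False by simp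
    qed
    then show ?thesis using m unfolding D by auto
  qed
  have "Min ?D = ?m"
  proof (rule Min_eqI[OF fin(2) _ mD])
    fix r assume r: "r \<in> ?D"
    show "?m \<le> r"
    proof (rule ccontr)
      assume "\<not> ?m \<le> r"
      then have "F ?m \<subseteq> F (r + 1)" using anti[of "r + 1" ?m] r m by auto
      then show False using r m unfolding D by blast
    qed
  qed
  then show ?thesis using assms(4) by (simp add: a_F_def filt_level_def)
qed

lemma poly_scale_0 [simp]: "poly_scale s 0 x = 0"
  by (simp add: poly_scale_def)

lemma poly_scale_pCons:
  assumes "vector_space s"
  shows "poly_scale s (pCons a p) x = map_poly (s a) x + pCons 0 (poly_scale s p x)"
proof -
  interpret vector_space s by fact
  have "map_poly (s 0) x = 0" by (intro poly_eqI) (simp add: coeff_map_poly)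
  then show ?thesis by (cases "p = 0 \<and> a = 0") (auto simp: poly_scale_def)
qed

lemma coeff_poly_scale:
  assumes "vector_space s"
  shows "coeff (poly_scale s p x) n = (\<Sum>i\<le>n. s (coeff p i) (coeff x (n - i)))"
proof -
  interpret vector_space s by fact
  show ?thesis
  proof (induction p arbitrary: n)
    case (pCons a p)
    then show ?case
      by (cases n) (simp_all add: poly_scale_pCons[OF assms] coeff_map_poly
          sum.atMost_Suc_shift del: sum.atMost_Suc)
  qed simp
qed

lemma poly_scale_u_var:
  assumes "vector_space s"
  shows "poly_scale s u_var x = pCons 0 x"
proof -
  interpret vector_space s by fact
  have "map_poly (s 0) x = 0" "map_poly (s 1) x = x"
    by (intro poly_eqI; simp add: coeff_map_poly)+
  then show ?thesis by (simp add: poly_scale_pCons[OF assms])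
qed

lemma module_poly_scale:
  assumes "vector_space s"
  shows "module (poly_scale s)"
proof -
  interpret vector_space s by fact
  note c = coeff_poly_scale[OF assms]
  have add: "poly_scale s (p + q) x = poly_scale s p x + poly_scale s q x" for p q x
    by (intro poly_eqI) (simp add: c scale_left_distrib sum.distrib)
  have addr: "poly_scale s p (x + y) = poly_scale s p x + poly_scale s p y" for p x y
    by (intro poly_eqI) (simp add: c scale_right_distrib sum.distrib)
  have map: "poly_scale s (smult a p) x = map_poly (s a) (poly_scale s p x)" for a p x
    by (intro poly_eqI) (simp add: c coeff_map_poly scale_sum_right)
  have map0: "map_poly (s 0) x = 0" for x by (intro poly_eqI) (simp add: coeff_map_poly)
  have shift: "poly_scale s (pCons 0 p) x = pCons 0 (poly_scale s p x)" for p x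
    by (simp add: poly_scale_pCons[OF assms] map0)
  show ?thesis
  proof
    show "poly_scale s p (poly_scale s q x) = poly_scale s (p * q) x" for p q x
      by (induction p) (simp_all add: poly_scale_pCons[OF assms] add map shift map0)
    show "poly_scale s 1 x = x" for x
      by (intro poly_eqI) (simp add: one_pCons poly_scale_pCons[OF assms] coeff_map_poly)
  qed (fact add addr)+
qed

lemma rees_submodule:
  assumes "vector_space s" "\<And>r. r \<in> {-1..int d} \<Longrightarrow> module.subspace s (A r)"
    and mono: "\<And>r. r \<in> {-1..<int d} \<Longrightarrow> A r \<subseteq> A (r + 1)"
  shows "module.subspace (poly_scale s) (rees d A)"
proof -
  interpret vector_space s by fact
  interpret P: module "poly_scale s" by (rule module_poly_scale[OF assms(1)])
  have sub: "subspace (A (min (int r) (int d)))" for r using assms(2) by auto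
  have le: "A i \<subseteq> A j" if "i \<le> j" "-1 \<le> i" "j \<le> int d" for i j
    using that
  proof (induction rule: int_ge_induct)
    case (step j)
    then show ?case using mono[of j] by auto
  qed simp
  show ?thesis
  proof (rule P.subspaceI)
    show "0 \<in> rees d A" using subspace_0[OF sub] by (simp add: rees_def)
    show "x + y \<in> rees d A" if "x \<in> rees d A" "y \<in> rees d A" for x y
      using that subspace_add[OF sub] by (simp add: rees_def)
    show "poly_scale s p x \<in> rees d A" if x: "x \<in> rees d A" for p x
    proof -
      have "s (coeff p i) (coeff x (n - i)) \<in> A (min (int n) (int d))" for n i
      proof -
        have "A (min (int (n - i)) (int d)) \<subseteq> A (min (int n) (int d))"
          by (rule le) auto
        then show ?thesis using x subspace_scale[OF sub] by (auto simp: rees_def)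
      qed
      then show ?thesis
        by (simp add: rees_def coeff_poly_scale[OF assms(1)] subspace_sum[OF sub])
    qed
  qed
qed

lemma rees_map_linear:
  assumes "vector_space sM" "vector_space sY" "filtered_response sM sY d F K R"
  shows "linear_map_on (rees d (dual_filtration sM F))
    (poly_scale dual_scale) (poly_scale sY) (rees_map R)"
proof -
  interpret vy: vector_space sY by fact
  interpret vd: vector_space "dual_scale :: 'a \<Rightarrow> ('b \<Rightarrow> 'a) \<Rightarrow> 'b \<Rightarrow> 'a"
    by (rule dual_vector_space)
  have dsub: "vd.subspace (dual sM)"
    using annihilator_subspace[OF assms(1), of "{}"] by (simp add: annihilator_def)
  have R: "R (p + q) = R p + R q" "R (dual_scale c p) = sY c (R p)"
    if "p \<in> dual sM" "q \<in> dual sM" for p q c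
    using that assms(3) by (auto simp: filtered_response_def linear_map_on_def)
  have z: "0 \<in> dual sM" using vd.subspace_0[OF dsub] .
  have R0: "R 0 = 0" using R(1)[OF z z] by simp
  have Rsum: "R (sum g I) = (\<Sum>i\<in>I. R (g i)) \<and> sum g I \<in> dual sM"
    if "finite I" "\<And>i. i \<in> I \<Longrightarrow> g i \<in> dual sM" for g and I :: "nat set"
    using that
    by (induction I) (simp_all add: R0 z R(1) vd.subspace_add[OF dsub])
  have cf: "coeff x n \<in> dual sM" if "x \<in> rees d (dual_filtration sM F)" for x n
    using that by (auto simp: rees_def dual_filtration_def annihilator_def)
  have cm: "coeff (rees_map R x) n = R (coeff x n)" for x n
    by (simp add: rees_map_def coeff_map_poly R0)
  show ?thesis
    unfolding linear_map_on_def
  proof (intro conjI ballI allI)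
    show "rees_map R (x + y) = rees_map R x + rees_map R y"
      if "x \<in> rees d (dual_filtration sM F)" "y \<in> rees d (dual_filtration sM F)" for x y
      by (intro poly_eqI) (simp add: cm R(1) cf that)
    show "rees_map R (poly_scale dual_scale p x) = poly_scale sY p (rees_map R x)"
      if x: "x \<in> rees d (dual_filtration sM F)" for p x
    proof (rule poly_eqI)
      fix n
      have "R (\<Sum>i\<le>n. dual_scale (coeff p i) (coeff x (n - i))) =
          (\<Sum>i\<le>n. R (dual_scale (coeff p i) (coeff x (n - i))))"
        by (rule Rsum[THEN conjunct1]) (simp_all add: vd.subspace_scale[OF dsub cf[OF x]])
      then show "coeff (rees_map R (poly_scale dual_scale p x)) n =
          coeff (poly_scale sY p (rees_map R x)) n"
        using R(2)[OF cf[OF x] z]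
        by (simp add: cm coeff_poly_scale[OF dual_vector_space] coeff_poly_scale[OF assms(2)])
    qed
  qed
qed

lemma quot_scale_coset:
  assumes "vector_space s" "module.subspace (poly_scale s) I"
  shows "quot_scale s I p (x +o I) = poly_scale s p x +o I"
proof -
  interpret P: module "poly_scale s" by (rule module_poly_scale[OF assms(1)])
  show ?thesis
    unfolding quot_scale_def
    by (rule descend_coset)
      (simp_all add: P.subspace_0[OF assms(2)] P.subspace_scale[OF assms(2)]
        coset_eq_iff[OF P.module_axioms assms(2)] P.scale_right_distrib)
qed

end

theory Submission
  imports Defs
begin

text \<open>
  Write \<open>D r\<close> for the dual filtration and \<open>K r\<close> for the filtration of the target.  All five
  conditions say that \<open>R\<close> never drops the level of a functional, and the hub of the proof is the
  one-step form of this: if \<open>q\<close> lies in \<open>D r\<close> and \<open>R q\<close> in \<open>K (r - 1)\<close>, then \<open>q\<close> lies in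
  \<open>D (r - 1)\<close>.  It implies strictness because every functional lies in \<open>D d\<close> and can be pushed down
  one degree at a time until it reaches the level of its image (\<open>strict_iff_one_step\<close>).

  Each condition is then a rewording.  The one-step form in degree \<open>r\<close> says that the \<open>r\<close>-th graded map
  has trivial kernel.  The level of an element is at most \<open>r\<close> exactly when the element lies in the
  \<open>r\<close>-th subspace, also for \<open>r = -1\<close>, where both say that it is zero (\<open>filt_level_le_iff\<close>); hence
  equality of levels is strictness.  In the Rees modules, \<open>u\<close> moves an element to the next degree
  without changing it: that \<open>R q u\<^sup>r\<close> is divisible by \<open>u\<close> in the target means that \<open>R q\<close> lies in
  \<open>K (r - 1)\<close>, while divisibility of \<open>q u\<^sup>r\<close> in the source means that \<open>q\<close> lies in \<open>D (r - 1)\<close>.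
  Injectivity of the Rees map covers the step \<open>r = 0\<close> and identifies \<open>q\<close> with the element
  supplied by saturation in the other steps (\<open>strict_iff_rees_saturated\<close>).  Saturation of a
  submodule is absence of \<open>u\<close>-torsion in the quotient by it
  (\<open>u_saturated_iff_no_u_torsion_quot\<close>).

  Finally, under strictness the functionals whose image has level at most \<open>r - 1\<close> are those
  annihilating \<open>F r\<close>, and a subspace is the common kernel of its annihilator.  The comparison of
  filtrations is carried out for an arbitrary filtered linear map; duality enters in this last
  point and in the identification of the graded pieces.
\<close>

section \<open>Levels in an exhaustive filtration\<close>

locale exhaustive_filtration = vector_space s
  for s :: "'k::field \<Rightarrow> 'v::ab_group_add \<Rightarrow> 'v" +
  fixes d :: nat and V :: "'v set" and A :: "int \<Rightarrow> 'v set"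
  assumes subspace_piece: "r \<in> {-1..int d} \<Longrightarrow> subspace (A r)"
    and step_mono: "r \<in> {-1..<int d} \<Longrightarrow> A r \<subseteq> A (r + 1)"
    and piece_bot: "A (-1) = {0}"
    and piece_top: "A (int d) = V"
begin

lemma mono:
  assumes "-1 \<le> i" "i \<le> j" "j \<le> int d"
  shows "A i \<subseteq> A j"
  using assms(2,1,3)
proof (induction rule: int_ge_induct)
  case (step j)
  then show ?case using step_mono[of j] by auto
qed simp

lemma piece_subset: "r \<in> {-1..int d} \<Longrightarrow> A r \<subseteq> V"
  using mono[of r "int d"] piece_top by auto

lemma zero_in_piece: "r \<in> {-1..int d} \<Longrightarrow> 0 \<in> A r"
  using subspace_0 subspace_piece by blast

lemma subspace_top: "subspace V"
  using subspace_piece[of "int d"] piece_top by simp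

text \<open>
  The conventions for the level of zero and for the lowest subspace agree, so that the level
  recovers the whole filtration: a nonzero element is not in \<open>A (-1)\<close>, hence has level at least \<open>0\<close>.
\<close>

lemma filt_level_le_iff:
  assumes "x \<in> V" "r \<in> {-1..int d}"
  shows "filt_level d A x \<le> Fin r \<longleftrightarrow> x \<in> A r"
proof (cases "x = 0")
  case True
  then show ?thesis using zero_in_piece assms(2) by (simp add: filt_level_def)
next
  case False
  let ?L = "{i \<in> {-1..int d}. x \<in> A i}"
  have fin: "finite ?L" by (rule finite_subset[of _ "{-1..int d}"]) auto
  have ne: "?L \<noteq> {}" using assms(1) piece_top by fastforce
  have "Min ?L \<le> r \<longleftrightarrow> x \<in> A r"
  proof
    assume "Min ?L \<le> r"
    then show "x \<in> A r"
      using Min_in[OF fin ne] mono[of "Min ?L" r] assms(2) by auto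
  next
    assume "x \<in> A r"
    then show "Min ?L \<le> r" using Min_le[OF fin] assms(2) by simp
  qed
  then show ?thesis using False by (simp add: filt_level_def)
qed

lemma coeff_rees_in_top: "x \<in> rees d A \<Longrightarrow> coeff x n \<in> V"
  using piece_subset[of "min (int n) (int d)"] by (auto simp: rees_def)

lemma monom_in_rees: "x \<in> A (int r) \<Longrightarrow> r \<le> d \<Longrightarrow> monom x r \<in> rees d A"
  using zero_in_piece by (auto simp: rees_def)

end

section \<open>Strictness of a filtered linear map\<close>

locale filtered_linear_map =
  dom: exhaustive_filtration s d V A + cod: exhaustive_filtration t d UNIV K
  for s :: "'k::field \<Rightarrow> 'v::ab_group_add \<Rightarrow> 'v" and t :: "'k \<Rightarrow> 'w::ab_group_add \<Rightarrow> 'w"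
    and d V A K +
  fixes f :: "'v \<Rightarrow> 'w"
  assumes linear: "linear_map_on V s t f"
    and filtered: "r \<in> {-1..int d} \<Longrightarrow> f ` A r \<subseteq> K r"
begin

definition strict :: bool
  where "strict \<longleftrightarrow> (\<forall>r\<in>{-1..int d}. {x \<in> V. f x \<in> K r} = A r)"

lemma map_zero: "f 0 = 0"
proof -
  have "0 \<in> V" using dom.subspace_0 dom.subspace_top by blast
  then have "f (0 + 0) = f 0 + f 0" using linear unfolding linear_map_on_def by blast
  then show ?thesis by simp
qed

lemma map_diff:
  assumes "x \<in> V" "y \<in> V"
  shows "f (x - y) = f x - f y"
proof -
  have "x - y \<in> V" using assms dom.subspace_diff dom.subspace_top by blast
  then have "f (x - y + y) = f (x - y) + f y"
    using linear assms unfolding linear_map_on_def by blast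
  then show ?thesis by simp
qed

lemma strict_iff:
  "strict \<longleftrightarrow> (\<forall>r\<in>{-1..int d}. \<forall>x\<in>V. f x \<in> K r \<longrightarrow> x \<in> A r)"
  unfolding strict_def using filtered dom.piece_subset by blast

lemma strict_in_piece_iff:
  "strict \<Longrightarrow> r \<in> {-1..int d} \<Longrightarrow> x \<in> V \<Longrightarrow> f x \<in> K r \<longleftrightarrow> x \<in> A r"
  unfolding strict_def by blast

text \<open>
  An element whose image lies in \<open>K r\<close> starts in \<open>A d\<close>; as long as its degree exceeds \<open>r\<close>, its image
  also lies one step below that degree, so it can be lowered, and this ends at \<open>A r\<close>.
\<close>

lemma strict_iff_one_step:
  "strict \<longleftrightarrow> (\<forall>r\<in>{0..int d}. \<forall>x\<in>A r. f x \<in> K (r - 1) \<longrightarrow> x \<in> A (r - 1))"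
proof
  assume st: "strict"
  show "\<forall>r\<in>{0..int d}. \<forall>x\<in>A r. f x \<in> K (r - 1) \<longrightarrow> x \<in> A (r - 1)"
  proof (intro ballI impI)
    fix r x assume r: "r \<in> {0..int d}" and x: "x \<in> A r" "f x \<in> K (r - 1)"
    then have "r - 1 \<in> {-1..int d}" "x \<in> V" using dom.piece_subset[of r] by auto
    then show "x \<in> A (r - 1)" using st x(2) unfolding strict_iff by blast
  qed
next
  assume down: "\<forall>r\<in>{0..int d}. \<forall>x\<in>A r. f x \<in> K (r - 1) \<longrightarrow> x \<in> A (r - 1)"
  show "strict"
    unfolding strict_iff
  proof (intro ballI impI)
    fix r x assume r: "r \<in> {-1..int d}" and x: "x \<in> V" "f x \<in> K r"
    have "x \<in> A i" if "i \<le> int d" "r \<le> i" for i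
      using that
    proof (induction rule: int_le_induct)
      case base
      then show ?case using x(1) dom.piece_top by simp
    next
      case (step i)
      have "f x \<in> K (i - 1)" using x(2) cod.mono[of r "i - 1"] r step by auto
      then show ?case using down step r by auto
    qed
    then show "x \<in> A r" using r by simp
  qed
qed

lemma strict_iff_levels_eq:
  "strict \<longleftrightarrow> (\<forall>x\<in>V. filt_level d K (f x) = filt_level d A x)"
proof
  assume st: "strict"
  show "\<forall>x\<in>V. filt_level d K (f x) = filt_level d A x"
  proof
    fix x assume x: "x \<in> V"
    show "filt_level d K (f x) = filt_level d A x"
    proof (cases "x = 0")
      case True
      then show ?thesis by (simp add: map_zero filt_level_def)
    next
      case False
      then have "x \<notin> A (-1)" using dom.piece_bot by simp
      then have "f x \<noteq> 0" using strict_in_piece_iff[OF st, of "-1" x] x cod.piece_bot by auto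
      moreover have "{r \<in> {-1..int d}. f x \<in> K r} = {r \<in> {-1..int d}. x \<in> A r}"
        using strict_in_piece_iff[OF st _ x] by auto
      ultimately show ?thesis using False by (simp add: filt_level_def)
    qed
  qed
next
  assume "\<forall>x\<in>V. filt_level d K (f x) = filt_level d A x"
  then show "strict"
    unfolding strict_iff using dom.filt_level_le_iff cod.filt_level_le_iff by (metis UNIV_I)
qed

text \<open>Two elements of \<open>A r\<close> have the same image modulo \<open>K (r - 1)\<close> iff their difference maps into it.\<close>

lemma strict_iff_gr_separates:
  "strict \<longleftrightarrow> (\<forall>r\<in>{0..int d}. \<forall>x\<in>A r. \<forall>y\<in>A r.
      f x +o K (r - 1) = f y +o K (r - 1) \<longrightarrow> x +o A (r - 1) = y +o A (r - 1))"
proof -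
  have "(\<forall>x\<in>A r. f x \<in> K (r - 1) \<longrightarrow> x \<in> A (r - 1)) \<longleftrightarrow>
      (\<forall>x\<in>A r. \<forall>y\<in>A r. f x +o K (r - 1) = f y +o K (r - 1) \<longrightarrow>
        x +o A (r - 1) = y +o A (r - 1))" (is "?ker \<longleftrightarrow> ?sep")
    if r: "r \<in> {0..int d}" for r
  proof -
    have sub: "dom.subspace (A (r - 1))" "cod.subspace (K (r - 1))" "dom.subspace (A r)"
      using r dom.subspace_piece cod.subspace_piece by auto
    have V: "x \<in> V" if "x \<in> A r" for x using that r dom.piece_subset[of r] by auto
    note eq = coset_eq_iff[OF dom.module_axioms sub(1)] coset_eq_iff[OF cod.module_axioms sub(2)]
    show ?thesis
    proof
      assume k: ?ker
      show ?sep
        unfolding eq using k dom.subspace_diff[OF sub(3)] V by (metis map_diff)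
    next
      assume s: ?sep
      have "0 \<in> A r" using dom.subspace_0[OF sub(3)] .
      then show ?ker
        using s unfolding eq by (metis map_zero diff_zero)
    qed
  qed
  then show ?thesis unfolding strict_iff_one_step by blast
qed

section \<open>Strictness in the Rees modules\<close>

lemma inj_on_rees_map_iff: "inj_on (map_poly f) (rees d A) \<longleftrightarrow> inj_on f V"
proof
  assume inj: "inj_on (map_poly f) (rees d A)"
  show "inj_on f V"
  proof (rule inj_onI)
    fix x y assume xy: "x \<in> V" "y \<in> V" "f x = f y"
    \<comment> \<open>The whole of \<open>V\<close> occurs in degree \<open>d\<close> of the Rees module.\<close>
    have "map_poly f (monom x d) = map_poly f (monom y d)"
      using xy(3) by (simp add: map_poly_monom map_zero)
    then have "monom x d = monom y d"
      using xy(1,2) dom.piece_top by (intro inj_onD[OF inj] dom.monom_in_rees) auto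
    then show "x = y" by simp
  qed
next
  assume inj: "inj_on f V"
  show "inj_on (map_poly f) (rees d A)"
  proof (intro inj_onI poly_eqI)
    fix x y n assume "x \<in> rees d A" "y \<in> rees d A" "map_poly f x = map_poly f y"
    moreover from this(3) have "f (coeff x n) = f (coeff y n)"
      by (metis coeff_map_poly map_zero)
    ultimately show "coeff x n = coeff y n"
      using inj_onD[OF inj] dom.coeff_rees_in_top by blast
  qed
qed

lemma strict_imp_inj:
  assumes "strict"
  shows "inj_on f V"
proof (rule inj_onI)
  fix x y assume xy: "x \<in> V" "y \<in> V" "f x = f y"
  then have "f (x - y) \<in> K (-1)" using cod.piece_bot by (simp add: map_diff)
  moreover have "x - y \<in> V" using xy dom.subspace_diff dom.subspace_top by blast
  ultimately have "x - y \<in> A (-1)" using strict_in_piece_iff[OF assms, of "-1"] by auto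
  then show "x = y" using dom.piece_bot by simp
qed

text \<open>
  If \<open>f\<close> is strict and \<open>u y\<close> is the image of \<open>x\<close>, the constant coefficient of \<open>x\<close> is killed by
  the injective map \<open>f\<close>, so \<open>x = u x'\<close>; strictness places the coefficients of \<open>x'\<close> in the right
  degrees because those of their image \<open>y\<close> are.  Conversely, saturation is applied to
  \<open>f x u\<^sup>r\<^sup>-\<^sup>1\<close>, whose multiple by \<open>u\<close> is the image of \<open>x u\<^sup>r\<close>.
\<close>

lemma strict_iff_rees_saturated:
  "strict \<longleftrightarrow> inj_on (map_poly f) (rees d A) \<and>
    u_saturated t (rees d K) (map_poly f ` rees d A)"
proof
  assume st: "strict"
  have inj: "inj_on f V" by (rule strict_imp_inj[OF st])
  have zV: "0 \<in> V" using dom.subspace_0 dom.subspace_top by blast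
  have "u_saturated t (rees d K) (map_poly f ` rees d A)"
    unfolding u_saturated_def poly_scale_u_var[OF cod.vector_space_axioms]
  proof (intro ballI impI)
    fix y assume y: "y \<in> rees d K" and "pCons 0 y \<in> map_poly f ` rees d A"
    then obtain x where x: "x \<in> rees d A" "pCons 0 y = map_poly f x" by blast
    obtain a x' where x': "x = pCons a x'" by (cases x)
    have cf: "coeff (pCons 0 y) n = f (coeff x n)" for n
      unfolding x(2) by (rule coeff_map_poly[where f = f, OF map_zero])
    have V: "coeff x' n \<in> V" for n
      using dom.coeff_rees_in_top[OF x(1), of "Suc n"] x' by simp
    have yx: "coeff y n = f (coeff x' n)" for n using cf[of "Suc n"] x' by simp
    have "coeff x' n \<in> A (min (int n) (int d))" for n
      using y strict_in_piece_iff[OF st _ V, of "min (int n) (int d)"] yx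
      by (auto simp: rees_def)
    then have "x' \<in> rees d A" by (simp add: rees_def)
    moreover have "y = map_poly f x'"
      by (intro poly_eqI) (simp add: yx coeff_map_poly map_zero)
    ultimately show "y \<in> map_poly f ` rees d A" by blast
  qed
  then show "inj_on (map_poly f) (rees d A) \<and> u_saturated t (rees d K) (map_poly f ` rees d A)"
    using inj inj_on_rees_map_iff by blast
next
  assume "inj_on (map_poly f) (rees d A) \<and> u_saturated t (rees d K) (map_poly f ` rees d A)"
  then have inj: "inj_on f V"
    and sat: "\<And>y. y \<in> rees d K \<Longrightarrow> pCons 0 y \<in> map_poly f ` rees d A \<Longrightarrow> y \<in> map_poly f ` rees d A"
    unfolding u_saturated_def poly_scale_u_var[OF cod.vector_space_axioms] inj_on_rees_map_iff
    by blast+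
  show "strict"
    unfolding strict_iff_one_step
  proof (intro ballI impI)
    fix r x assume r: "r \<in> {0..int d}" and x: "x \<in> A r" "f x \<in> K (r - 1)"
    have xV: "x \<in> V" using x(1) r dom.piece_subset[of r] by auto
    show "x \<in> A (r - 1)"
    proof (cases "r = 0")
      case True
      then have "f x = f 0" using x(2) cod.piece_bot map_zero by simp
      then have "x = 0"
        using inj_onD[OF inj _ xV] dom.subspace_0[OF dom.subspace_top] by blast
      then show ?thesis using True dom.piece_bot by simp
    next
      case False
      then obtain n where n: "r = int (Suc n)"
        using r by (metis atLeastAtMost_iff nonneg_int_cases not0_implies_Suc of_nat_0)
      then have nd: "Suc n \<le> d" using r by auto
      have "monom (f x) n \<in> rees d K" using x(2) n nd by (intro cod.monom_in_rees) auto
      moreover have "pCons 0 (monom (f x) n) \<in> map_poly f ` rees d A"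
      proof
        show "monom x (Suc n) \<in> rees d A" using x(1) n nd by (intro dom.monom_in_rees) auto
        show "pCons 0 (monom (f x) n) = map_poly f (monom x (Suc n))"
          unfolding map_poly_monom[where f = f, OF map_zero] by (simp add: monom_Suc)
      qed
      ultimately obtain z where z: "z \<in> rees d A" "monom (f x) n = map_poly f z"
        using sat by blast
      have "f x = coeff (monom (f x) n) n" by simp
      also have "\<dots> = f (coeff z n)" unfolding z(2) by (simp add: coeff_map_poly map_zero)
      finally have "x = coeff z n"
        using inj_onD[OF inj _ xV] dom.coeff_rees_in_top[OF z(1)] by blast
      then show ?thesis using z(1) n nd by (auto simp: rees_def dest!: spec[of _ n])
    qed
  qed
qed

end

section \<open>Saturation and torsion\<close>

lemma subspace_linear_map_on_image:
  assumes "module s" "module t" "module.subspace s S" "linear_map_on S s t f"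
  shows "module.subspace t (f ` S)"
proof -
  interpret s: module s by fact
  interpret t: module t by fact
  have add: "f (x + y) = f x + f y" and scale: "f (s c x) = t c (f x)"
    if "x \<in> S" "y \<in> S" for x y c
    using assms(4) that by (auto simp: linear_map_on_def)
  note S = s.subspace_0[OF assms(3)] s.subspace_add[OF assms(3)] s.subspace_scale[OF assms(3)]
  show ?thesis
  proof (rule t.subspaceI)
    have "f 0 = 0" using add[OF S(1) S(1)] by simp
    then show "0 \<in> f ` S" using S(1) by force
    show "x + y \<in> f ` S" if "x \<in> f ` S" "y \<in> f ` S" for x y
      using that add S(2) by (metis (no_types, lifting) image_iff)
    show "t c x \<in> f ` S" if "x \<in> f ` S" for c x
      using that scale S(3) by (metis (no_types, lifting) image_iff)
  qed
qed

text \<open>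
  A class in \<open>T / I\<close> is killed by \<open>u\<close> iff the multiple by \<open>u\<close> of a representative lies in \<open>I\<close>.
  Torsion by a power \<open>u\<^sup>n\<close> is peeled off one factor at a time, which stays inside \<open>T\<close>.
\<close>

lemma u_saturated_iff_no_u_torsion_quot:
  assumes vs: "vector_space s"
    and T: "module.subspace (poly_scale s) T" and I: "module.subspace (poly_scale s) I"
  shows "u_saturated s T I \<longleftrightarrow> no_u_torsion_quot s T I"
proof -
  interpret P: module "poly_scale s" by (rule module_poly_scale[OF vs])
  have coset: "x +o I = I \<longleftrightarrow> x \<in> I" for x
    using coset_eq_iff[OF P.module_axioms I, of x 0] by simp
  have "no_u_torsion_quot s T I \<longleftrightarrow> (\<forall>x\<in>T. \<forall>n. poly_scale s (u_var ^ n) x \<in> I \<longrightarrow> x \<in> I)"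
    by (simp add: no_u_torsion_quot_def quot_def quot_scale_coset[OF vs I] coset)
  also have "\<dots> \<longleftrightarrow> u_saturated s T I"
  proof
    assume "\<forall>x\<in>T. \<forall>n. poly_scale s (u_var ^ n) x \<in> I \<longrightarrow> x \<in> I"
    then show "u_saturated s T I" unfolding u_saturated_def by (metis power_one_right)
  next
    assume sat: "u_saturated s T I"
    have "x \<in> I" if "x \<in> T" "poly_scale s (u_var ^ n) x \<in> I" for n x
      using that
    proof (induction n arbitrary: x)
      case (Suc n)
      have "poly_scale s (u_var ^ n) (poly_scale s u_var x) \<in> I"
        using Suc.prems(2) by (simp only: P.scale_scale power_Suc2)
      then have "poly_scale s u_var x \<in> I"
        using Suc.IH P.subspace_scale[OF T Suc.prems(1)] by blast
      then show ?case using sat Suc.prems(1) unfolding u_saturated_def by blast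
    qed simp
    then show "\<forall>x\<in>T. \<forall>n. poly_scale s (u_var ^ n) x \<in> I \<longrightarrow> x \<in> I" by blast
  qed
  finally show ?thesis by blast
qed

section \<open>Dual filtrations\<close>

text \<open>
  A vector outside \<open>S\<close> stays independent from a basis of \<open>S\<close>, so some functional vanishes on that
  basis and takes the value \<open>1\<close> at the vector.
\<close>

lemma common_kernel_annihilator:
  assumes vs: "vector_space sM" and S: "module.subspace sM S"
  shows "(\<Inter>q\<in>annihilator sM S. {x. q x = (0 :: 'k::field)}) = S"
proof (intro set_eqI iffI)
  interpret vs: vector_space sM by fact
  interpret vp: vector_space_pair sM "(*) :: 'k \<Rightarrow> 'k \<Rightarrow> 'k"
    by unfold_locales (auto simp: distrib_left distrib_right)
  fix x assume x: "x \<in> (\<Inter>q\<in>annihilator sM S. {x. q x = 0})"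
  show "x \<in> S"
  proof (rule ccontr)
    assume nx: "x \<notin> S"
    obtain B where B: "B \<subseteq> S" "vs.independent B" "S \<subseteq> vs.span B"
      by (rule vs.basis_exists)
    have "vs.span B \<subseteq> S" using vs.span_minimal[OF B(1) S] .
    then have xB: "x \<notin> vs.span B" using nx by blast
    then have "vs.independent (insert x B)" using B(2) vs.independent_insertI by blast
    then obtain q where q: "Vector_Spaces.linear sM (*) q"
      "\<forall>b\<in>insert x B. q b = (if b = x then 1 else 0)"
      using vp.linear_independent_extend[of _ "\<lambda>b. if b = x then 1 else 0"] by blast
    have "q b = 0" if "b \<in> B" for b
    proof -
      have "b \<noteq> x" using that B(1) nx by blast
      then show ?thesis using q(2) that by simp
    qed
    then have "q y = 0" if "y \<in> vs.span B" for y
      using vp.linear_eq_0_on_span[OF q(1), of B y] that by blast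
    then have "q \<in> annihilator sM S" using q(1) B(3) by (auto simp: annihilator_def dual_def)
    then have "q x = 0" using x by blast
    then show False using q(2) by simp
  qed
qed (auto simp: annihilator_def)

lemma increasing_filtration_exhaustive:
  assumes "vector_space sY" "increasing_filtration sY d K"
  shows "exhaustive_filtration sY d UNIV K"
  using assms
  by (auto simp: increasing_filtration_def exhaustive_filtration_def exhaustive_filtration_axioms_def)

lemma dual_filtration_exhaustive:
  fixes sM :: "'k::field \<Rightarrow> 'm::ab_group_add \<Rightarrow> 'm"
  assumes vs: "vector_space sM" and F: "decreasing_filtration sM d F"
  shows "exhaustive_filtration dual_scale d (dual sM) (dual_filtration sM F)"
proof (intro exhaustive_filtration.intro exhaustive_filtration_axioms.intro)
  show "vector_space (dual_scale :: 'k \<Rightarrow> ('m \<Rightarrow> 'k) \<Rightarrow> 'm \<Rightarrow> 'k)" by (rule dual_vector_space)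
  show "module.subspace dual_scale (dual_filtration sM F r)" for r
    unfolding dual_filtration_def by (rule annihilator_subspace[OF vs])
  show "dual_filtration sM F r \<subseteq> dual_filtration sM F (r + 1)" if "r \<in> {-1..<int d}" for r
  proof -
    have "r + 1 \<in> {0..int d}" using that by auto
    then have "F (r + 1 + 1) \<subseteq> F (r + 1)"
      using F unfolding decreasing_filtration_def by blast
    then show ?thesis by (auto simp: dual_filtration_def annihilator_def)
  qed
  have q0: "q 0 = 0" if "q \<in> dual sM" for q
    using that unfolding dual_iff[OF vs] by (metis add_cancel_right_right)
  show "dual_filtration sM F (- 1) = {0}"
    using F
    by (auto simp: dual_filtration_def annihilator_def decreasing_filtration_def fun_eq_iff
        dual_iff[OF vs])
  show "dual_filtration sM F (int d) = dual sM"
    using F q0 by (auto simp: dual_filtration_def annihilator_def decreasing_filtration_def)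
qed

text \<open>
  Restriction identifies the domain of the graded map with the cosets of \<open>D (r - 1)\<close> in \<open>D r\<close>,
  and under this identification the graded map sends the coset of \<open>q\<close> to that of \<open>R q\<close>.
\<close>

lemma inj_on_gr_map_iff:
  fixes sM :: "'k::field \<Rightarrow> 'm::ab_group_add \<Rightarrow> 'm"
  assumes "vector_space sM" "vector_space sY"
    and "decreasing_filtration sM d F" "increasing_filtration sY d K"
    and "filtered_response sM sY d F K R" and r: "r \<in> {0..int d}"
  defines "D \<equiv> dual_filtration sM F"
  shows "inj_on (gr_map sM F K R r) (gr_F_dual sM F r) \<longleftrightarrow>
    (\<forall>p\<in>D r. \<forall>q\<in>D r. R p +o K (r - 1) = R q +o K (r - 1) \<longrightarrow> p +o D (r - 1) = q +o D (r - 1))"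
proof -
  note bij = restrict_gr_bij[OF assms(1,3) r, folded D_def]
  have "inj_on (gr_map sM F K R r) (gr_F_dual sM F r) \<longleftrightarrow>
      inj_on (gr_map sM F K R r \<circ> descend (restrict_gr F r)) (gr_incr D r)"
    using bij comp_inj_on_iff[of "descend (restrict_gr F r)" "gr_incr D r" "gr_map sM F K R r"]
    by (simp add: bij_betw_def)
  also have "\<dots> \<longleftrightarrow> (\<forall>p\<in>D r. \<forall>q\<in>D r. R p +o K (r - 1) = R q +o K (r - 1) \<longrightarrow>
      p +o D (r - 1) = q +o D (r - 1))"
    using gr_map_restrict[OF assms(1-5) r, folded D_def]
    by (simp add: inj_on_def gr_incr_def quot_def)
  finally show ?thesis .
qed

theorem theorem5p2:
  fixes sM :: "'k::field_char_0 \<Rightarrow> 'm::ab_group_add \<Rightarrow> 'm"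
    and sY :: "'k \<Rightarrow> 'y::ab_group_add \<Rightarrow> 'y"
    and B :: "'m set" and d :: nat
    and F :: "int \<Rightarrow> 'm set" and K :: "int \<Rightarrow> 'y set"
    and R :: "('m \<Rightarrow> 'k) \<Rightarrow> 'y"
  assumes "finite_dimensional_vector_space sM B" and "vector_space sY"
    and "decreasing_filtration sM d F" and "increasing_filtration sY d K"
    and "filtered_response sM sY d F K R"
  shows
    "(strict_response sM d F K R \<longleftrightarrow>
        (\<forall>r\<in>{0..int d}. inj_on (gr_map sM F K R r) (gr_F_dual sM F r))) \<and>
     (strict_response sM d F K R \<longleftrightarrow>
        (\<forall>q\<in>dual sM. nu_K d K (R q) = a_F sM d F q)) \<and>
     (strict_response sM d F K R \<longleftrightarrow>
        inj_on (rees_map R) (rees d (dual_filtration sM F)) \<and>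
        u_saturated sY (rees d K) (rees_map R ` rees d (dual_filtration sM F))) \<and>
     (strict_response sM d F K R \<longleftrightarrow>
        inj_on (rees_map R) (rees d (dual_filtration sM F)) \<and>
        no_u_torsion_quot sY (rees d K) (rees_map R ` rees d (dual_filtration sM F))) \<and>
     (strict_response sM d F K R \<longrightarrow>
        (\<forall>r\<in>{0..int d + 1}.
          F r = (\<Inter>q\<in>{q \<in> dual sM. nu_K d K (R q) \<le> Fin (r - 1)}. {x. q x = 0})))"
proof -
  interpret vm: finite_dimensional_vector_space sM B by fact
  note vs = vm.vector_space_axioms
  define D where "D = dual_filtration sM F"
  interpret D: exhaustive_filtration dual_scale d "dual sM" D
    unfolding D_def by (rule dual_filtration_exhaustive[OF vs assms(3)])
  interpret K: exhaustive_filtration sY d UNIV K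
    by (rule increasing_filtration_exhaustive[OF assms(2,4)])
  interpret fm: filtered_linear_map dual_scale sY d "dual sM" D K R
    by unfold_locales (use assms(5) in \<open>auto simp: filtered_response_def D_def\<close>)
  have strict: "strict_response sM d F K R \<longleftrightarrow> fm.strict"
    unfolding strict_response_def fm.strict_def by (simp add: D_def)

  have gr: "fm.strict \<longleftrightarrow> (\<forall>r\<in>{0..int d}. inj_on (gr_map sM F K R r) (gr_F_dual sM F r))"
    using inj_on_gr_map_iff[OF vs assms(2-5), folded D_def]
    unfolding fm.strict_iff_gr_separates by simp

  have levels: "fm.strict \<longleftrightarrow> (\<forall>q\<in>dual sM. nu_K d K (R q) = a_F sM d F q)"
    unfolding fm.strict_iff_levels_eq by (simp add: nu_K_def a_F_def D_def)

  have sat: "fm.strict \<longleftrightarrow> inj_on (rees_map R) (rees d D) \<and>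
      u_saturated sY (rees d K) (rees_map R ` rees d D)"
    unfolding rees_map_def by (rule fm.strict_iff_rees_saturated)

  have target: "module.subspace (poly_scale sY) (rees d K)"
    by (rule rees_submodule[OF assms(2)]) (fact K.subspace_piece K.step_mono)+
  have source: "module.subspace (poly_scale dual_scale) (rees d D)"
    by (rule rees_submodule[OF dual_vector_space]) (fact D.subspace_piece D.step_mono)+
  have image: "module.subspace (poly_scale sY) (rees_map R ` rees d D)"
    using rees_map_linear[OF vs assms(2,5), folded D_def]
    by (rule subspace_linear_map_on_image[OF module_poly_scale[OF dual_vector_space]
          module_poly_scale[OF assms(2)] source])
  note torsion = u_saturated_iff_no_u_torsion_quot[OF assms(2) target image]

  have recover: "F r = (\<Inter>q\<in>{q \<in> dual sM. nu_K d K (R q) \<le> Fin (r - 1)}. {x. q x = 0})"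
    if st: "fm.strict" and r: "r \<in> {0..int d + 1}" for r
  proof -
    have r': "r - 1 \<in> {-1..int d}" using r by auto
    have "nu_K d K (R q) \<le> Fin (r - 1) \<longleftrightarrow> q \<in> D (r - 1)" if "q \<in> dual sM" for q
      unfolding nu_K_def K.filt_level_le_iff[OF UNIV_I r']
      by (rule fm.strict_in_piece_iff[OF st r' that])
    then have "{q \<in> dual sM. nu_K d K (R q) \<le> Fin (r - 1)} = annihilator sM (F r)"
      using D.piece_subset[OF r'] by (auto simp: D_def dual_filtration_def)
    moreover have "module.subspace sM (F r)"
      using assms(3) r by (simp add: decreasing_filtration_def)
    ultimately show ?thesis using common_kernel_annihilator[OF vs] by simp
  qed

  show ?thesis
    unfolding strict D_def[symmetric] using gr levels sat torsion recover by blast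
qed

end
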